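(* Let $a<b$ be real numbers, let $r$ be a positive continuous function on $(a,b)$ and let $p$ be a positive integer. Put $R(a,x)=\int_a^x r(t)\,dt$. Then for all measurable functions $f\ge 0$ on $(a,b)$ such that all integrals below exist and are finite, $$\int_a^b r(x)\left(\int_x^b f(t)\,dt\right)^{p+1}dx\le (b-a)^p\int_a^b R(a,x)\,(f(x))^{p+1}\,dx.$$
   Context: Standing assumption: all functions are measurable and all the integrals appearing in the inequality (including those defining $R(a,x)$ and $\int_x^b f$ for $x\in(a,b)$) exist and are finite. *)

theory Defs
  imports "HOL-Analysis.Analysis"
begin

definition weight_integral :: "(real \<Rightarrow> real) \<Rightarrow> real \<Rightarrow> real \<Rightarrow> real"
  where "weight_integral r a x = (LINT t:{a<..<x}|lebesgue. r t)"

end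

theory Submission
  imports Defs
begin

text \<open>
  For each \<open>x\<close>, the power mean inequality on \<open>(x, b)\<close> bounds the power \<open>p + 1\<close> of the integral of \<open>f\<close>
  over \<open>(x, b)\<close> by \<open>(b - a)^p\<close> times the integral of \<open>f^(p + 1)\<close> over \<open>(x, b)\<close>. Multiplying by \<open>r x\<close>,
  integrating in \<open>x\<close> and exchanging the order of integration turns the weight \<open>r x\<close> into \<open>R(a, t)\<close>.
\<close>

text \<open>Convexity of \<open>y ^ (n + 1)\<close>: its graph lies above the tangent at
  \<open>m\<close>, here rearranged so that no subtraction occurs. In the induction step, the
  previous inequality times \<open>y\<close> leaves exactly the nonnegative gap
  \<open>(n + 1) * m ^ n * (y - m)^2\<close>.\<close>

lemma weighted_power_tangent:
  fixes y m :: real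
  assumes "0 \<le> y" "0 \<le> m"
  shows "(real n + 1) * m ^ n * y \<le> y ^ (n + 1) + real n * m ^ (n + 1)"
proof (induction n)
  case 0
  then show ?case by simp
next
  case (Suc n)
  have "0 \<le> (real n + 1) * m ^ n * (y - m)\<^sup>2"
    using assms by simp
  moreover have "((real n + 1) * m ^ n * y) * y \<le> (y ^ (n + 1) + real n * m ^ (n + 1)) * y"
    using Suc assms by (intro mult_right_mono)
  ultimately show ?case
    by (simp add: algebra_simps power2_eq_square)
qed

text \<open>Jensen's inequality for the power \<open>n + 1\<close>, obtained by integrating the
  tangent inequality with contact point the mean of \<open>f\<close>. The right side is a
  nonnegative integral because only \<open>f\<close> is assumed integrable, so the integral of
  \<open>f ^ (n + 1)\<close> may be infinite.\<close>

lemma power_integral_le_nn_integral_power: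
  fixes f :: "'a \<Rightarrow> real"
  assumes "finite_measure M" and f: "integrable M f" and nonneg: "AE x in M. 0 \<le> f x"
  shows "ennreal ((\<integral>x. f x \<partial>M) ^ (n + 1))
           \<le> ennreal (measure M (space M) ^ n) * (\<integral>\<^sup>+x. ennreal (f x ^ (n + 1)) \<partial>M)"
proof -
  interpret finite_measure M by fact
  define I where "I = (\<integral>x. f x \<partial>M)"
  define L where "L = measure M (space M)"
  have I0: "0 \<le> I" unfolding I_def using nonneg by (rule integral_nonneg_AE)
  have L0: "0 \<le> L" unfolding L_def by simp
  have f_meas [measurable]: "f \<in> borel_measurable M" using f by simp
  show ?thesis
  proof (cases "L = 0")
    \<comment> \<open>On a null space the mean is undefined, but then the integral of
      \<open>f\<close> vanishes, and so does its power since the exponent \<open>n + 1\<close> is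
      positive.\<close>
    case True
    then have "emeasure M (space M) = 0"
      by (simp add: L_def emeasure_eq_measure)
    then have "AE x in M. f x = 0"
      by (intro AE_I[where N="space M"]) auto
    then have "I = 0" unfolding I_def using integral_eq_zero_AE by blast
    then show ?thesis by (simp add: I_def)
  next
    case False
    with L0 have L: "0 < L" by simp
    show ?thesis
    proof (cases "(\<integral>\<^sup>+x. ennreal (f x ^ (n + 1)) \<partial>M) = \<infinity>")
      case True
      moreover have "ennreal (L ^ n) \<noteq> 0" using L by (simp add: ennreal_eq_0_iff not_le)
      ultimately show ?thesis by (simp add: L_def[symmetric] ennreal_mult_eq_top_iff)
    next
      case False
      have nonneg_pow: "AE x in M. 0 \<le> f x ^ (n + 1)"
        using nonneg by eventually_elim simp
      have "(\<integral>\<^sup>+x. ennreal (norm (f x ^ (n + 1))) \<partial>M) = (\<integral>\<^sup>+x. ennreal (f x ^ (n + 1)) \<partial>M)"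
        using nonneg_pow by (intro nn_integral_cong_AE) (auto elim!: eventually_mono)
      then have int: "integrable M (\<lambda>x. f x ^ (n + 1))"
        using False by (intro integrableI_bounded) (simp_all add: less_top)
      \<comment> \<open>The contact point is the mean value: the linear term then integrates to
        \<open>(n + 1) * m ^ (n + 1) * L\<close>, which exceeds the constant term by exactly
        \<open>L * m ^ (n + 1)\<close>.\<close>
      define m where "m = I / L"
      have m0: "0 \<le> m" using I0 L by (simp add: m_def)
      have "(\<integral>x. (real n + 1) * m ^ n * f x \<partial>M) \<le> (\<integral>x. f x ^ (n + 1) + real n * m ^ (n + 1) \<partial>M)"
      proof (rule integral_mono_AE)
        show "AE x in M. (real n + 1) * m ^ n * f x \<le> f x ^ (n + 1) + real n * m ^ (n + 1)"
          using nonneg by eventually_elim (rule weighted_power_tangent[OF _ m0])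
      qed (use f int in auto)
      then have "(real n + 1) * m ^ n * I \<le> (\<integral>x. f x ^ (n + 1) \<partial>M) + L * (real n * m ^ (n + 1))"
        using f int by (simp add: I_def L_def)
      moreover have "I = m * L" using L by (simp add: m_def)
      ultimately have "L * m ^ (n + 1) \<le> (\<integral>x. f x ^ (n + 1) \<partial>M)"
        by (simp add: algebra_simps)
      \<comment> \<open>The factor \<open>L ^ n\<close> completes \<open>L * m ^ (n + 1)\<close> to
        \<open>(L * m) ^ (n + 1)\<close>, which is \<open>I ^ (n + 1)\<close>.\<close>
      then have "L ^ n * (L * m ^ (n + 1)) \<le> L ^ n * (\<integral>x. f x ^ (n + 1) \<partial>M)"
        using L by (intro mult_left_mono) auto
      moreover have "L ^ n * (L * m ^ (n + 1)) = I ^ (n + 1)"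
        using L by (simp add: m_def power_divide field_simps)
      ultimately have "I ^ (n + 1) \<le> L ^ n * (\<integral>x. f x ^ (n + 1) \<partial>M)"
        by simp
      then have "ennreal (I ^ (n + 1)) \<le> ennreal (L ^ n) * ennreal (\<integral>x. f x ^ (n + 1) \<partial>M)"
        using L by (simp add: ennreal_leI flip: ennreal_mult')
      then show ?thesis
        using nn_integral_eq_integral[OF int nonneg_pow] by (simp add: I_def L_def)
    qed
  qed
qed

lemma set_integral_nonneg:
  fixes f :: "'a \<Rightarrow> real"
  assumes "\<And>x. x \<in> A \<Longrightarrow> 0 \<le> f x"
  shows "0 \<le> (LINT x:A|M. f x)"
  unfolding set_lebesgue_integral_def using assms
  by (intro Bochner_Integration.integral_nonneg) (auto simp: indicator_def)

lemma nn_integral_eq_set_integral: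
  fixes f :: "'a \<Rightarrow> real"
  assumes "set_integrable M A f" "\<And>x. x \<in> A \<Longrightarrow> 0 \<le> f x"
  shows "(\<integral>\<^sup>+x. ennreal (indicator A x * f x) \<partial>M) = ennreal (LINT x:A|M. f x)"
  using nn_integral_eq_integral[of M "\<lambda>x. indicator A x * f x"] assms
  by (simp add: set_integrable_def set_lebesgue_integral_def indicator_def)

text \<open>A countable cover by sets of finite measure still works after completion, since the
  measure of the old sets is unchanged. This makes Tonelli's theorem applicable to
  \<open>lebesgue\<close>.\<close>

lemma sigma_finite_completion:
  assumes "sigma_finite_measure M"
  shows "sigma_finite_measure (completion M)"
proof -
  obtain A where A: "countable A" "A \<subseteq> sets M" "\<Union>A = space M" "\<forall>a\<in>A. emeasure M a \<noteq> \<infinity>"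
    using assms by (auto simp: sigma_finite_measure_def)
  then show ?thesis
    unfolding sigma_finite_measure_def
    by (intro exI[of _ A]) (auto simp: subset_eq)
qed

theorem theorem2p19:
  fixes a b :: real and r f :: "real \<Rightarrow> real" and p :: nat
  assumes "a < b"
    and "continuous_on {a<..<b} r"
    and "\<And>x. x \<in> {a<..<b} \<Longrightarrow> 0 < r x"
    and "0 < p"
    and "f \<in> borel_measurable (lebesgue_on {a<..<b})"
    and "\<And>x. x \<in> {a<..<b} \<Longrightarrow> 0 \<le> f x"
    and "\<And>x. x \<in> {a<..<b} \<Longrightarrow> set_integrable lebesgue {a<..<x} r"
    and "\<And>x. x \<in> {a<..<b} \<Longrightarrow> set_integrable lebesgue {x<..<b} f"
    and "set_integrable lebesgue {a<..<b}
           (\<lambda>x. r x * (LINT t:{x<..<b}|lebesgue. f t) ^ (p + 1))"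
    and "set_integrable lebesgue {a<..<b}
           (\<lambda>x. weight_integral r a x * f x ^ (p + 1))"
  shows "(LINT x:{a<..<b}|lebesgue. r x * (LINT t:{x<..<b}|lebesgue. f t) ^ (p + 1))
           \<le> (b - a) ^ p * (LINT x:{a<..<b}|lebesgue. weight_integral r a x * f x ^ (p + 1))"
proof -
  interpret pair_sigma_finite lebesgue "lebesgue :: real measure"
    by (intro pair_sigma_finite.intro sigma_finite_completion sigma_finite_lborel)
  define g where "g x = (LINT t:{x<..<b}|lebesgue. f t)" for x
  define R where "R = weight_integral r a"
  \<comment> \<open>Extension by zero turns measurability on the interval into measurability on the
    whole line, as needed on the product space.\<close>
  define r' where "r' x = indicator {a<..<b} x * r x" for x
  define f' where "f' x = indicator {a<..<b} x * f x" for x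
  note r = assms(2,3) and f = assms(5,6) and r_int = assms(7) and f_int = assms(8)
  have r'_meas [measurable]: "r' \<in> borel_measurable lebesgue"
  proof -
    have "r \<in> borel_measurable (lebesgue_on {a<..<b})"
      using r(1) by (intro continuous_imp_measurable_on_sets_lebesgue) auto
    then show ?thesis
      by (simp add: r'_def[abs_def] borel_measurable_restrict_space_iff)
  qed
  have f'_meas [measurable]: "f' \<in> borel_measurable lebesgue"
    using f(1) by (simp add: f'_def[abs_def] borel_measurable_restrict_space_iff)
  have [measurable]: "(\<lambda>x. x) \<in> borel_measurable lebesgue"
    by (simp add: measurable_completion)
  have g0: "0 \<le> g x" if "x \<in> {a<..<b}" for x
    unfolding g_def using f(2) that by (intro set_integral_nonneg) auto
  have R0: "0 \<le> R x" if "x \<in> {a<..<b}" for x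
    unfolding R_def weight_integral_def using r(2) that
    by (intro set_integral_nonneg) (auto intro!: less_imp_le)
  \<comment> \<open>The kernel for Tonelli lives on the triangle a < x < t < b: outside the interval
    \<open>r'\<close> and \<open>f'\<close> vanish, and the exponent \<open>p + 1\<close> is
    positive.\<close>
  define K where
    "K x t = ennreal (r' x) * indicator {(x, t). x < t} (x, t) * ennreal (f' t ^ (p + 1))" for x t :: real
  have K_meas [measurable]: "case_prod K \<in> borel_measurable (lebesgue \<Otimes>\<^sub>M lebesgue)"
  proof -
    have "(\<lambda>z. ennreal (r' (fst z)) * (if fst z < snd z then 1 else 0) * ennreal (f' (snd z) ^ (p + 1)))
            \<in> borel_measurable (lebesgue \<Otimes>\<^sub>M lebesgue)"
      by measurable
    then show ?thesis
      by (simp add: K_def indicator_def case_prod_unfold of_bool_def)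
  qed

  have inner_t: "ennreal (indicator {a<..<b} x * (r x * g x ^ (p + 1)))
      \<le> ennreal ((b - a) ^ p) * (\<integral>\<^sup>+t. K x t \<partial>lebesgue)" for x
  proof (cases "x \<in> {a<..<b}")
    case x: True
    let ?M = "restrict_space lebesgue {x<..<b}"
    have fin: "finite_measure ?M"
      using x by (intro finite_measureI) (simp add: emeasure_restrict_space space_restrict_space)
    have "ennreal (g x ^ (p + 1))
        \<le> ennreal (measure ?M (space ?M) ^ p) * (\<integral>\<^sup>+t. ennreal (f t ^ (p + 1)) \<partial>?M)"
    proof -
      have "integrable ?M f"
        using f_int[OF x] by (simp add: integrable_restrict_space set_integrable_def)
      moreover have "AE t in ?M. 0 \<le> f t"
        using f(2) x by (intro AE_I2) (auto simp: space_restrict_space)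
      moreover have "g x = (\<integral>t. f t \<partial>?M)"
        by (simp add: g_def integral_restrict_space set_lebesgue_integral_def)
      ultimately show ?thesis
        using power_integral_le_nn_integral_power[OF fin, of f p] by (simp only:)
    qed
    \<comment> \<open>The measure of the interval from \<open>x\<close> to \<open>b\<close> is
      \<open>b - x\<close>, at most \<open>b - a\<close>; this gives a constant independent of
      \<open>x\<close>.\<close>
    also have "\<dots> \<le> ennreal ((b - a) ^ p) * (\<integral>\<^sup>+t. ennreal (f t ^ (p + 1)) \<partial>?M)"
      using x by (intro mult_right_mono ennreal_leI power_mono)
        (auto simp: measure_restrict_space space_restrict_space)
    finally have "ennreal (r x) * ennreal (g x ^ (p + 1))
        \<le> ennreal (r x) * (ennreal ((b - a) ^ p) * (\<integral>\<^sup>+t. ennreal (f t ^ (p + 1)) \<partial>?M))"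
      by (rule mult_left_mono) simp
    also have "(\<integral>\<^sup>+t. ennreal (f t ^ (p + 1)) \<partial>?M)
        = (\<integral>\<^sup>+t. indicator {(x, t). x < t} (x, t) * ennreal (f' t ^ (p + 1)) \<partial>lebesgue)"
      using x by (subst nn_integral_restrict_space)
        (auto intro!: nn_integral_cong simp: f'_def indicator_def)
    also have "ennreal (r x) * (ennreal ((b - a) ^ p) * \<dots>) = ennreal ((b - a) ^ p) * (\<integral>\<^sup>+t. K x t \<partial>lebesgue)"
    proof -
      have "(\<integral>\<^sup>+t. K x t \<partial>lebesgue)
          = ennreal (r x) * (\<integral>\<^sup>+t. indicator {(x, t). x < t} (x, t) * ennreal (f' t ^ (p + 1)) \<partial>lebesgue)"
        unfolding K_def mult.assoc using x
        by (subst nn_integral_cmult) (auto simp: r'_def indicator_def)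
      then show ?thesis
        by (simp only: mult.left_commute)
    qed
    finally show ?thesis
      using x r(2)[OF x] g0[OF x] by (simp add: ennreal_mult)
  qed simp

  have inner_x: "(\<integral>\<^sup>+x. K x t \<partial>lebesgue) = ennreal (indicator {a<..<b} t * (R t * f t ^ (p + 1)))" for t
  proof (cases "t \<in> {a<..<b}")
    case t: True
    have "(\<integral>\<^sup>+x. K x t \<partial>lebesgue)
        = (\<integral>\<^sup>+x. ennreal (f' t ^ (p + 1)) * ennreal (indicator {a<..<t} x * r x) \<partial>lebesgue)"
      \<comment> \<open>For fixed \<open>t\<close> the triangle cuts out a < x < t, so only
        \<open>r\<close> on that interval remains and its integral is \<open>R t\<close>.\<close>
      using t by (intro nn_integral_cong) (auto simp: K_def r'_def indicator_def mult.commute)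
    also have "\<dots> = ennreal (f' t ^ (p + 1)) * (\<integral>\<^sup>+x. ennreal (indicator {a<..<t} x * r x) \<partial>lebesgue)"
      using r_int[OF t] by (intro nn_integral_cmult) (auto simp: set_integrable_def)
    also have "(\<integral>\<^sup>+x. ennreal (indicator {a<..<t} x * r x) \<partial>lebesgue) = ennreal (R t)"
      unfolding R_def weight_integral_def
      using r_int[OF t] r(2) t
      by (intro nn_integral_eq_set_integral) (auto intro: less_imp_le)
    finally show ?thesis
      using t f(2)[OF t] R0[OF t] by (simp add: f'_def ennreal_mult mult.commute)
  qed (simp add: K_def f'_def)

  \<comment> \<open>Both sides of the claim have nonnegative integrable integrands, so they can be
    compared as nonnegative integrals, where the exchange of order requires only measurability of
    \<open>K\<close>.\<close>
  have "ennreal (LINT x:{a<..<b}|lebesgue. r x * g x ^ (p + 1))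
      = (\<integral>\<^sup>+x. ennreal (indicator {a<..<b} x * (r x * g x ^ (p + 1))) \<partial>lebesgue)"
    using assms(9) r(2) g0 unfolding g_def
    by (intro nn_integral_eq_set_integral[symmetric] mult_nonneg_nonneg zero_le_power) (auto intro: less_imp_le)
  also have "\<dots> \<le> (\<integral>\<^sup>+x. ennreal ((b - a) ^ p) * (\<integral>\<^sup>+t. K x t \<partial>lebesgue) \<partial>lebesgue)"
    by (intro nn_integral_mono inner_t)
  also have "\<dots> = ennreal ((b - a) ^ p) * (\<integral>\<^sup>+x. (\<integral>\<^sup>+t. K x t \<partial>lebesgue) \<partial>lebesgue)"
    by (intro nn_integral_cmult) measurable
  also have "(\<integral>\<^sup>+x. (\<integral>\<^sup>+t. K x t \<partial>lebesgue) \<partial>lebesgue) = (\<integral>\<^sup>+t. (\<integral>\<^sup>+x. K x t \<partial>lebesgue) \<partial>lebesgue)"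
    using Fubini'[OF K_meas] by simp
  also have "\<dots> = (\<integral>\<^sup>+t. ennreal (indicator {a<..<b} t * (R t * f t ^ (p + 1))) \<partial>lebesgue)"
    by (simp only: inner_x)
  also have "\<dots> = ennreal (LINT t:{a<..<b}|lebesgue. R t * f t ^ (p + 1))"
    using assms(10) f(2) R0 unfolding R_def
    by (intro nn_integral_eq_set_integral mult_nonneg_nonneg zero_le_power)
  also have "ennreal ((b - a) ^ p) * \<dots> = ennreal ((b - a) ^ p * (LINT t:{a<..<b}|lebesgue. R t * f t ^ (p + 1)))"
    using assms(1) by (simp add: ennreal_mult')
  \<comment> \<open>Returning from \<open>ennreal\<close> to the reals requires the right side to be
    nonnegative.\<close>
  finally show ?thesis
    using assms(1) f(2) R0 unfolding g_def R_def
    by (subst (asm) ennreal_le_iff) (auto intro!: mult_nonneg_nonneg set_integral_nonneg)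
qed

end
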